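(* Let $\Psi=(S,C,F)$ be a separating expansion system such that $S_0$ is a topological space and all $C_i$ are Hausdorff topological spaces, and give $\hat C=\prod_{i}C_i$ the product topology. Let $y\in S_0$ and suppose $\Psi$ is convergent with respect to $y$, with limit $y^{[\infty]}$. If $\hat P\colon S_0\to\hat C$ is continuous at $y^{[\infty]}$, then $y=y^{[\infty]}$, i.e. $\Psi$ is accurate with respect to $y$. In particular, if $\Psi$ is convergent (with respect to all $y\in S_0$) and $\hat P$ is continuous on $S_0$, then $\Psi$ is accurate (with respect to all $y\in S_0$).
   Context: $\mathbb N=\{0,1,2,\dots\}$. An expansion system $\Psi=(S,C,F)$ consists of sets $S_i$ ($i\in\mathbb N$), each with a distinguished neutral element $\nu_i\in S_i$, sets $C_i$ ($i\in\mathbb N$), and maps $P_i\colon S_i\to C_i$ and $E_i\colon S_i\to S_{i+1}$ such that $E_i(\nu_i)=\nu_{i+1}$ and $F_i=(P_i,E_i)\colon S_i\to C_i\times S_{i+1}$ is injective, for all $i$. For $y\in S_0$ put $y_0=y$, $y_{i+1}=E_i(y_i)$, $\hat P_i(y)=c_i=P_i(y_i)$. Put $\hat C=\prod_{i\in\mathbb N}C_i$ and $\hat P\colon S_0\to\hat C$, $\hat P(y)=(c_0,c_1,\dots)$. $\Psi$ is separating if $\hat P$ is injective. Properness and convergents: given $y\in S_0$ with coefficients $c_i$ and $n\in\mathbb N$, set $y^{[n]}_n=\nu_n$ and, for $i=n-1,\dots,0$, $y^{[n]}_i=F_i^{-1}(c_i,y^{[n]}_{i+1})$, provided $(c_i,y^{[n]}_{i+1})\in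 F_i(S_i)$. If this proviso holds at every step, $\Psi$ is called proper at order $n$ with respect to $y$, and $y^{[n]}:=y^{[n]}_0$ is the $n$-th convergent of $y$. When $S_0$ is a topological space, $\Psi$ is convergent with respect to $y\in S_0$ if it is proper at every order with respect to $y$ and the sequence $(y^{[n]})_n$ converges in $S_0$ to some element, denoted $y^{[\infty]}$. It is accurate with respect to $y$ if moreover $y^{[\infty]}=y$. *)

theory Defs
  imports "HOL-Analysis.Analysis"
begin

text \<open>
  All the sets \<open>S\<^sub>i\<close> are subsets of one type \<open>'s\<close>, and all the \<open>C\<^sub>i\<close> are subsets of one type
  \<open>'c\<close>. This is no restriction: a sequence of arbitrary sets embeds into its disjoint union.
\<close>

record ('s, 'c) expansion_data =
  St :: "nat \<Rightarrow> 's set"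
  Co :: "nat \<Rightarrow> 'c set"
  neutral :: "nat \<Rightarrow> 's"
  Pmap :: "nat \<Rightarrow> 's \<Rightarrow> 'c"
  Emap :: "nat \<Rightarrow> 's \<Rightarrow> 's"

definition Fmap :: "('s, 'c) expansion_data \<Rightarrow> nat \<Rightarrow> 's \<Rightarrow> 'c \<times> 's" where
  "Fmap \<Psi> i s = (Pmap \<Psi> i s, Emap \<Psi> i s)"

definition expansion_system :: "('s, 'c) expansion_data \<Rightarrow> bool" where
  "expansion_system \<Psi> \<longleftrightarrow>
     (\<forall>i. neutral \<Psi> i \<in> St \<Psi> i \<and>
          Pmap \<Psi> i \<in> St \<Psi> i \<rightarrow> Co \<Psi> i \<and>
          Emap \<Psi> i \<in> St \<Psi> i \<rightarrow> St \<Psi> (Suc i) \<and>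
          Emap \<Psi> i (neutral \<Psi> i) = neutral \<Psi> (Suc i) \<and>
          inj_on (Fmap \<Psi> i) (St \<Psi> i))"

primrec iterate :: "('s, 'c) expansion_data \<Rightarrow> 's \<Rightarrow> nat \<Rightarrow> 's" where
  "iterate \<Psi> y 0 = y"
| "iterate \<Psi> y (Suc i) = Emap \<Psi> i (iterate \<Psi> y i)"

definition Phat :: "('s, 'c) expansion_data \<Rightarrow> 's \<Rightarrow> nat \<Rightarrow> 'c" where
  "Phat \<Psi> y i = Pmap \<Psi> i (iterate \<Psi> y i)"

definition separating :: "('s, 'c) expansion_data \<Rightarrow> bool" where
  "separating \<Psi> \<longleftrightarrow> inj_on (Phat \<Psi>) (St \<Psi> 0)"

text \<open>
  \<open>descend \<Psi> y i k\<close> is \<open>y\<^sup>[\<^sup>n\<^sup>]\<^sub>i\<close> for \<open>n = i + k\<close>, so that the descending recursion on \<open>i\<close> for fixed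
  \<open>n\<close> becomes a recursion on the number \<open>k\<close> of remaining steps. If \<open>\<Psi>\<close> is not proper at order \<open>n\<close>
  with respect to \<open>y\<close>, the values of \<open>inv_into\<close> from the first failing step on are meaningless;
  but then \<open>proper_at\<close> is false.
\<close>

primrec descend :: "('s, 'c) expansion_data \<Rightarrow> 's \<Rightarrow> nat \<Rightarrow> nat \<Rightarrow> 's" where
  "descend \<Psi> y i 0 = neutral \<Psi> i"
| "descend \<Psi> y i (Suc k) = inv_into (St \<Psi> i) (Fmap \<Psi> i) (Phat \<Psi> y i, descend \<Psi> y (Suc i) k)"

definition stage :: "('s, 'c) expansion_data \<Rightarrow> 's \<Rightarrow> nat \<Rightarrow> nat \<Rightarrow> 's" where
  "stage \<Psi> y n i = descend \<Psi> y i (n - i)"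

definition proper_at :: "('s, 'c) expansion_data \<Rightarrow> nat \<Rightarrow> 's \<Rightarrow> bool" where
  "proper_at \<Psi> n y \<longleftrightarrow>
     (\<forall>i<n. (Phat \<Psi> y i, stage \<Psi> y n (Suc i)) \<in> Fmap \<Psi> i ` St \<Psi> i)"

definition convergent_of :: "('s, 'c) expansion_data \<Rightarrow> 's \<Rightarrow> nat \<Rightarrow> 's" where
  "convergent_of \<Psi> y n = stage \<Psi> y n 0"

text \<open>
  The topology \<open>X\<close> on \<open>S\<^sub>0\<close> need not be Hausdorff, so a limit of the convergents need not be
  unique, and \<open>y\<^sup>[\<^sup>\<infinity>\<^sup>]\<close> is not a function of \<open>y\<close>. Hence \<open>expansion_limit X \<Psi> y z\<close> says that \<open>\<Psi>\<close> is
  convergent with respect to \<open>y\<close> and that \<open>z\<close> may serve as \<open>y\<^sup>[\<^sup>\<infinity>\<^sup>]\<close>.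
\<close>

definition expansion_limit ::
  "'s topology \<Rightarrow> ('s, 'c) expansion_data \<Rightarrow> 's \<Rightarrow> 's \<Rightarrow> bool" where
  "expansion_limit X \<Psi> y z \<longleftrightarrow>
     (\<forall>n. proper_at \<Psi> n y) \<and> limitin X (convergent_of \<Psi> y) z sequentially"

definition expansion_convergent ::
  "'s topology \<Rightarrow> ('s, 'c) expansion_data \<Rightarrow> 's \<Rightarrow> bool" where
  "expansion_convergent X \<Psi> y \<longleftrightarrow> (\<exists>z. expansion_limit X \<Psi> y z)"

definition expansion_accurate ::
  "'s topology \<Rightarrow> ('s, 'c) expansion_data \<Rightarrow> 's \<Rightarrow> bool" where
  "expansion_accurate X \<Psi> y \<longleftrightarrow> expansion_limit X \<Psi> y y"

end

theory Submission
  imports Defs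
begin

text \<open>
  The \<open>n\<close>-th convergent reproduces the coefficients \<open>c\<^sub>0, \<dots>, c\<^sub>n\<^sub>-\<^sub>1\<close> of \<open>y\<close>, so each coordinate of
  the images of the convergents under \<open>Phat \<Psi>\<close> is eventually constant and these images converge to
  \<open>Phat \<Psi> y\<close>. Continuity at the limit \<open>z\<close> makes them converge to \<open>Phat \<Psi> z\<close> as well; the product
  is Hausdorff, so the two agree, and separation gives \<open>y = z\<close>.
\<close>

lemma limitin_topcontinuous_at:
  assumes "limitin X f z F" "topcontinuous_at X Y g z"
  shows "limitin Y (g \<circ> f) (g z) F"
  unfolding limitin_def
proof (intro conjI allI impI)
  show "g z \<in> topspace Y"
    using assms(2) by (auto simp: topcontinuous_at_def)
  fix V assume "openin Y V \<and> g z \<in> V"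
  then obtain U where "openin X U" "z \<in> U" "\<forall>x\<in>U. g x \<in> V"
    using assms(2) unfolding topcontinuous_at_def by meson
  moreover from this have "eventually (\<lambda>n. f n \<in> U) F"
    using assms(1) by (simp add: limitin_def)
  ultimately show "eventually (\<lambda>n. (g \<circ> f) n \<in> V) F"
    by (auto elim: eventually_mono)
qed

text \<open>\<open>limitin\<close> requires its limit to lie in the space; this provides that for
  the coordinates of \<open>Phat \<Psi> y\<close>.\<close>

lemma Phat_in_Co:
  assumes "expansion_system \<Psi>" "y \<in> St \<Psi> 0"
  shows "Phat \<Psi> y i \<in> Co \<Psi> i"
proof -
  have "iterate \<Psi> y i \<in> St \<Psi> i"
    using assms by (induction i) (auto simp: expansion_system_def Pi_iff)
  then show ?thesis
    using assms(1) by (auto simp: Phat_def expansion_system_def Pi_iff)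
qed

text \<open>Properness puts the pair into the image of \<open>Fmap \<Psi> i\<close>, where
  \<open>inv_into\<close> is a genuine right inverse; the claims are the two components of that
  equation.\<close>

lemma
  assumes "proper_at \<Psi> n y" "i < n"
  shows Pmap_stage: "Pmap \<Psi> i (stage \<Psi> y n i) = Phat \<Psi> y i"
    and Emap_stage: "Emap \<Psi> i (stage \<Psi> y n i) = stage \<Psi> y n (Suc i)"
proof -
  have mem: "(Phat \<Psi> y i, stage \<Psi> y n (Suc i)) \<in> Fmap \<Psi> i ` St \<Psi> i"
    using assms by (simp add: proper_at_def)
  \<comment> \<open>As \<open>i < n\<close>, the count \<open>n - i\<close> is a successor, so the
    recursive clause of \<open>descend\<close> applies.\<close>
  have eq: "stage \<Psi> y n i = inv_into (St \<Psi> i) (Fmap \<Psi> i) (Phat \<Psi> y i, stage \<Psi> y n (Suc i))"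
    using assms(2) by (simp add: stage_def Suc_diff_Suc[symmetric])
  have "Fmap \<Psi> i (stage \<Psi> y n i) = (Phat \<Psi> y i, stage \<Psi> y n (Suc i))"
    unfolding eq using mem by (rule f_inv_into_f)
  then show "Pmap \<Psi> i (stage \<Psi> y n i) = Phat \<Psi> y i"
    and "Emap \<Psi> i (stage \<Psi> y n i) = stage \<Psi> y n (Suc i)"
    by (simp_all add: Fmap_def)
qed

text \<open>Climbing from the convergent with \<open>Emap\<close> retraces the descent, so its
  iterates up to index \<open>i\<close> are the stages.\<close>

lemma Phat_convergent_of:
  assumes "proper_at \<Psi> n y" "i < n"
  shows "Phat \<Psi> (convergent_of \<Psi> y n) i = Phat \<Psi> y i"
proof -
  have "iterate \<Psi> (convergent_of \<Psi> y n) i = stage \<Psi> y n i"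
    using assms(2) by (induction i) (simp_all add: convergent_of_def Emap_stage[OF assms(1)])
  then show ?thesis
    \<comment> \<open>The instantiation unfolds \<open>Phat\<close> on the left side only; the right
      side must keep the form in \<open>Pmap_stage\<close>.\<close>
    using assms by (simp add: Phat_def[of _ "convergent_of _ _ _"] Pmap_stage)
qed

text \<open>Since \<open>X\<close> need not be Hausdorff, limits are compared coordinatewise in the
  Hausdorff spaces \<open>Y i\<close>, and injectivity of \<open>Phat \<Psi>\<close> carries the
  equality back.\<close>

lemma expansion_limit_unique:
  assumes sys: "expansion_system \<Psi>" and sep: "separating \<Psi>"
    and X: "topspace X = St \<Psi> 0" and Y: "\<And>i. topspace (Y i) = Co \<Psi> i"
    and haus: "\<And>i. Hausdorff_space (Y i)"
    and y: "y \<in> St \<Psi> 0" and lim: "expansion_limit X \<Psi> y z"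
    and cont: "topcontinuous_at X (product_topology Y UNIV) (Phat \<Psi>) z"
  shows "y = z"
proof -
  have conv: "limitin X (convergent_of \<Psi> y) z sequentially" and proper: "proper_at \<Psi> n y" for n
    using lim by (auto simp: expansion_limit_def)
  have z: "z \<in> St \<Psi> 0"
    using limitin_topspace[OF conv] X by simp
  have "limitin (product_topology Y UNIV) (Phat \<Psi> \<circ> convergent_of \<Psi> y) (Phat \<Psi> z) sequentially"
    using conv cont by (rule limitin_topcontinuous_at)
  then have to_z: "limitin (Y i) (\<lambda>n. Phat \<Psi> (convergent_of \<Psi> y n) i) (Phat \<Psi> z i) sequentially" for i
    by (simp add: limitin_componentwise)
  have to_y: "limitin (Y i) (\<lambda>n. Phat \<Psi> (convergent_of \<Psi> y n) i) (Phat \<Psi> y i) sequentially" for i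
  proof (rule limitin_eventually)
    show "Phat \<Psi> y i \<in> topspace (Y i)"
      using Phat_in_Co[OF sys y] Y by simp
    show "\<forall>\<^sub>F n in sequentially. Phat \<Psi> (convergent_of \<Psi> y n) i = Phat \<Psi> y i"
      \<comment> \<open>Order \<open>n\<close> secures only the coefficients below \<open>n\<close>,
        hence the strict bound.\<close>
      using eventually_gt_at_top[of i] by eventually_elim (rule Phat_convergent_of[OF proper])
  qed
  have "Phat \<Psi> y = Phat \<Psi> z"
    using limitin_Hausdorff_unique[OF to_y to_z _ haus] by auto
  then show ?thesis
    using sep y z by (auto simp: separating_def dest: inj_onD)
qed

theorem theorem3p10:
  fixes \<Psi> :: "('s, 'c) expansion_data"
    and X :: "'s topology"
    and Y :: "nat \<Rightarrow> 'c topology"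
  assumes "expansion_system \<Psi>"
    and "separating \<Psi>"
    and "topspace X = St \<Psi> 0"
    and "\<And>i. topspace (Y i) = Co \<Psi> i"
    and "\<And>i. Hausdorff_space (Y i)"
  shows "(\<forall>y\<in>St \<Psi> 0. \<forall>z. expansion_limit X \<Psi> y z \<longrightarrow>
            topcontinuous_at X (product_topology Y UNIV) (Phat \<Psi>) z \<longrightarrow>
            y = z \<and> expansion_accurate X \<Psi> y) \<and>
         ((\<forall>y\<in>St \<Psi> 0. expansion_convergent X \<Psi> y) \<longrightarrow>
            continuous_map X (product_topology Y UNIV) (Phat \<Psi>) \<longrightarrow>
            (\<forall>y\<in>St \<Psi> 0. expansion_accurate X \<Psi> y))"
proof -
  have pointwise: "y = z \<and> expansion_accurate X \<Psi> y"
    if "y \<in> St \<Psi> 0" "expansion_limit X \<Psi> y z"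
      "topcontinuous_at X (product_topology Y UNIV) (Phat \<Psi>) z" for y z
    using expansion_limit_unique[OF assms that] that(2)
    by (simp add: expansion_accurate_def)
  moreover have "expansion_accurate X \<Psi> y"
    if y: "y \<in> St \<Psi> 0" and conv: "expansion_convergent X \<Psi> y"
      and cont: "continuous_map X (product_topology Y UNIV) (Phat \<Psi>)" for y
  proof -
    obtain z where z: "expansion_limit X \<Psi> y z"
      using conv by (auto simp: expansion_convergent_def)
    \<comment> \<open>A continuous map is continuous at the points of \<open>topspace X\<close>, so
      \<open>z\<close> must be placed there first.\<close>
    then have "z \<in> topspace X"
      by (auto simp: expansion_limit_def dest: limitin_topspace)
    then show ?thesis
      using pointwise[OF y z] cont by (auto simp: continuous_map_eq_topcontinuous_at)
  qed
  ultimately show ?thesis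
    by blast
qed

end
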